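(* Let $\psi$ be a real-valued function of the integer $n \ge 2$ with $\psi(n) > 0$. Then, for each $n \ge 2$, the proportion of sequences $A \in \mathcal{B}_n$ satisfying $$\mu(A) > \sqrt{2n\psi(n)}$$ is bounded above by $$\frac{2n}{\psi(n)e^{\psi(n)}}.$$
   Context: A binary sequence of length $n$ is an $n$-tuple $A = (a_0, a_1, \ldots, a_{n-1})$ with each $a_j \in \{+1,-1\}$. $\mathcal{B}_n$ denotes the set of all $2^n$ binary sequences of length $n$. For $0 \le k \le n-1$, the (aperiodic) autocorrelations of $A$ are $c_k = \sum_{j=0}^{n-k-1} a_j a_{j+k}$. For $n \ge 2$, the peak sidelobe level of $A$ is $\mu(A) = \max_{1\le k\le n-1} |c_k|$. The proportion of sequences $A \in \mathcal{B}_n$ with a given property is the number of such sequences divided by $2^n$ (equivalently, the probability of the property when the $a_j$ are independent and each equally likely to be $+1$ or $-1$). *)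

theory Defs
  imports Complex_Main
begin

definition binary_sequences :: "nat \<Rightarrow> int list set" where
  "binary_sequences n = {A. length A = n \<and> set A \<subseteq> {1, -1}}"

definition autocorrelation :: "int list \<Rightarrow> nat \<Rightarrow> int" where
  "autocorrelation A k = (\<Sum>j<length A - k. A ! j * A ! (j + k))"

text \<open>Only meaningful for sequences of length at least 2; otherwise the maximum ranges
  over the empty set.\<close>

definition peak_sidelobe_level :: "int list \<Rightarrow> int" where
  "peak_sidelobe_level A = Max ((\<lambda>k. \<bar>autocorrelation A k\<bar>) ` {1..length A - 1})"

definition proportion :: "nat \<Rightarrow> (int list \<Rightarrow> bool) \<Rightarrow> real" where
  "proportion n P = real (card {A \<in> binary_sequences n. P A}) / 2 ^ n"

end

theory Submission imports Defs begin

text \<open>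
  The proof is a union bound over the shifts $k$, each shift being handled by a Chernoff bound.

  Although the summands $a_j a_{j+k}$ of $c_k$ overlap, for $k \ge 1$ they behave like independent
  signs: in $c_k$ the first entry $a_0$ occurs only in the product $a_0 a_k$, so averaging over
  $a_0$ alone contributes the factor $\cosh s$ to the moment generating function, whatever the
  other entries are. Peeling off entries from the front gives the exact mean $(\cosh s)^{n-k}$ of
  $e^{s c_k}$ (lemma \<open>autocorrelation_mgf\<close>). From $\cosh s \le e^{s^2/2}$ and the choice
  $s = t/(n-k)$ one gets the tail bound $2 e^{-t^2/(2(n-k))}$ for $|c_k| > t$
  (lemma \<open>autocorrelation_tail\<close>).

  With $t^2 = 2n\psi$ the exponent is $-n\psi/(n-k)$. Bounding every shift by the worst case would
  give the factor $2n e^{-\psi}$ and lose the denominator $\psi$; instead $n/(n-k) \ge 1 + k/n$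
  compares the sum over $k$ with $e^{-\psi}$ times the geometric series
  $\sum_{k \ge 1} e^{-k\psi/n} = 1/(e^{\psi/n} - 1) \le n/\psi$
  (lemma \<open>sum_tail_bounds_le\<close>).
\<close>

section \<open>Sums over binary sequences\<close>

lemma binary_sequences_0: "binary_sequences 0 = {[]}"
  by (auto simp: binary_sequences_def)

lemma binary_sequences_Suc:
  "binary_sequences (Suc n) = (\<lambda>(a, A). a # A) ` ({1, -1} \<times> binary_sequences n)"
proof (rule set_eqI)
  fix A
  show "A \<in> binary_sequences (Suc n) \<longleftrightarrow> A \<in> (\<lambda>(a, A). a # A) ` ({1, -1} \<times> binary_sequences n)"
    by (cases A) (auto simp: binary_sequences_def image_iff)
qed

lemma finite_binary_sequences: "finite (binary_sequences n)"
  by (induction n) (simp_all add: binary_sequences_0 binary_sequences_Suc)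

lemma sum_binary_sequences_Suc:
  "(\<Sum>A\<in>binary_sequences (Suc n). f A) = (\<Sum>A\<in>binary_sequences n. f (1 # A) + f (-1 # A))"
proof -
  have "inj_on (\<lambda>(a, A). a # A) ({1, -1} \<times> binary_sequences n)"
    by (auto simp: inj_on_def)
  then have "(\<Sum>A\<in>binary_sequences (Suc n). f A)
      = (\<Sum>(a, A)\<in>{1, -1} \<times> binary_sequences n. f (a # A))"
    by (simp add: binary_sequences_Suc sum.reindex case_prod_unfold)
  also have "\<dots> = (\<Sum>A\<in>binary_sequences n. f (1 # A) + f (-1 # A))"
    by (simp flip: sum.cartesian_product add: sum.distrib)
  finally show ?thesis .
qed

section \<open>The moment generating function of an autocorrelation\<close>

lemma autocorrelation_Cons:
  assumes "k \<ge> 1"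
  shows "autocorrelation (a # A) k
    = (if k \<le> length A then a * A ! (k - 1) else 0) + autocorrelation A k"
proof (cases "k \<le> length A")
  case True
  then have "length (a # A) - k = Suc (length A - k)"
    by simp
  then show ?thesis
    using True assms
    by (simp add: autocorrelation_def sum.lessThan_Suc_shift nth_Cons_pos del: sum.lessThan_Suc)
qed (simp add: autocorrelation_def)

text \<open>
  Prepending $a$ to $A$, when $A$ has at least $k$ entries, changes $c_k$ by $a b$, where
  $b = \pm 1$ is the entry of $A$ that ends up at distance $k$ from $a$; since
  $e^{sb} + e^{-sb} = 2\cosh s$ for either sign of $b$, the two choices of $a$ contribute a factor
  that does not depend on $A$.
\<close>

lemma autocorrelation_mgf:
  assumes "k \<ge> 1"
  shows "(\<Sum>A\<in>binary_sequences n. exp (s * real_of_int (autocorrelation A k)))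
    = 2 ^ n * cosh s ^ (n - k)"
proof (induction n)
  case 0
  show ?case
    by (simp add: binary_sequences_0 autocorrelation_def)
next
  case (Suc n)
  have step: "exp (s * real_of_int (autocorrelation (1 # A) k))
        + exp (s * real_of_int (autocorrelation (-1 # A) k))
      = 2 * (if k \<le> n then cosh s else 1) * exp (s * real_of_int (autocorrelation A k))"
    if A: "A \<in> binary_sequences n" for A
  proof (cases "k \<le> n")
    case True
    have len: "length A = n" and sub: "set A \<subseteq> {1, -1}"
      using A by (auto simp: binary_sequences_def)
    have "A ! (k - 1) \<in> set A"
      using True assms len by simp
    then have sign: "A ! (k - 1) = 1 \<or> A ! (k - 1) = -1"
      using sub by blast
    let ?c = "real_of_int (autocorrelation A k)"
    have "exp (s * real_of_int (autocorrelation (1 # A) k))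
        + exp (s * real_of_int (autocorrelation (-1 # A) k)) = exp (s + s * ?c) + exp (- s + s * ?c)"
      using sign True len assms by (auto simp: autocorrelation_Cons distrib_left right_diff_distrib)
    also have "\<dots> = 2 * cosh s * exp (s * ?c)"
      by (simp only: exp_add cosh_field_def) (simp add: distrib_right)
    finally show ?thesis
      using True by simp
  next
    case False
    then show ?thesis
      using A assms by (simp add: autocorrelation_Cons binary_sequences_def)
  qed
  have "(\<Sum>A\<in>binary_sequences (Suc n). exp (s * real_of_int (autocorrelation A k)))
      = 2 * (if k \<le> n then cosh s else 1) * (2 ^ n * cosh s ^ (n - k))"
    unfolding sum_binary_sequences_Suc Suc.IH[symmetric] sum_distrib_left
    by (rule sum.cong) (simp_all only: step)
  also have "\<dots> = 2 ^ Suc n * cosh s ^ (Suc n - k)"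
    by (simp add: Suc_diff_le)
  finally show ?case .
qed

text \<open>
  Compare power series termwise: the coefficients of $s^{2m}$ are $1/(2m)!$ and $1/(2^m m!)$.
\<close>

lemma cosh_le_exp_half_square: "cosh s \<le> exp (s\<^sup>2 / 2)" for s :: real
proof -
  have coeff: "2 ^ m * fact m \<le> (fact (2 * m) :: real)" for m
  proof (induction m)
    case (Suc m)
    have "2 ^ Suc m * fact (Suc m) = (2 * real (Suc m)) * (2 ^ m * fact m)"
      by simp
    also have "\<dots> \<le> (2 * real (Suc m)) * fact (2 * m)"
      using Suc.IH by (intro mult_left_mono) auto
    also have "\<dots> \<le> (2 * real (Suc m)) * (real (2 * m + 1) * fact (2 * m))"
      by (intro mult_left_mono) (auto simp: algebra_simps)
    also have "\<dots> = fact (2 * Suc m)"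
      by (simp add: algebra_simps)
    finally show ?case .
  qed simp
  let ?f = "\<lambda>m. if even m then s ^ m /\<^sub>R fact m else 0"
  have "strict_mono (\<lambda>m::nat. 2 * m)"
    by (simp add: strict_mono_def)
  moreover have "?f m = 0" if "m \<notin> range (\<lambda>m. 2 * m)" for m
    using that by (auto simp: dvd_def)
  ultimately have "(\<lambda>m. ?f (2 * m)) sums cosh s \<longleftrightarrow> ?f sums cosh s"
    by (rule sums_mono_reindex)
  then have cosh: "(\<lambda>m. s ^ (2 * m) /\<^sub>R fact (2 * m)) sums cosh s"
    using cosh_converges[of s] by simp
  have exp: "(\<lambda>m. (s\<^sup>2 / 2) ^ m /\<^sub>R fact m) sums exp (s\<^sup>2 / 2)"
    by (rule exp_converges)
  have le: "s ^ (2 * m) /\<^sub>R fact (2 * m) \<le> (s\<^sup>2 / 2) ^ m /\<^sub>R fact m" for m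
  proof -
    have "s ^ (2 * m) / fact (2 * m) \<le> s ^ (2 * m) / (2 ^ m * fact m)"
      using coeff[of m] by (intro divide_left_mono) auto
    also have "\<dots> = (s\<^sup>2 / 2) ^ m / fact m"
      unfolding power_mult power_divide by (simp only: divide_divide_eq_left)
    finally show ?thesis
      by (simp only: real_scaleR_def divide_inverse mult.commute)
  qed
  show ?thesis
    by (rule sums_le[OF le cosh exp])
qed

section \<open>The tail of a single autocorrelation\<close>

lemma autocorrelation_tail:
  assumes k: "1 \<le> k" "k < n" and t: "t \<ge> 0"
  shows "proportion n (\<lambda>A. real_of_int \<bar>autocorrelation A k\<bar> > t)
    \<le> 2 * exp (- (t\<^sup>2 / (2 * real (n - k))))"
proof -
  define m where "m = real (n - k)"
  have m: "m > 0"
    using k by (simp add: m_def)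
  \<comment> \<open>The minimiser of the exponent $s^2 m / 2 - s t$ of the Chernoff bound.\<close>
  define s where "s = t / m"
  have s: "s \<ge> 0"
    using t m by (simp add: s_def)
  let ?c = "\<lambda>A. real_of_int (autocorrelation A k)"
  let ?T = "{A \<in> binary_sequences n. real_of_int \<bar>autocorrelation A k\<bar> > t}"
  have markov: "exp (s * t) \<le> exp (s * ?c A) + exp (- s * ?c A)" if "A \<in> ?T" for A
  proof -
    have "s * t \<le> s * \<bar>?c A\<bar>"
      using that s by (intro mult_left_mono) auto
    then have "exp (s * t) \<le> exp (s * \<bar>?c A\<bar>)"
      by simp
    also have "\<dots> \<le> exp (s * ?c A) + exp (- s * ?c A)"
      by (cases "?c A \<ge> 0") auto
    finally show ?thesis .
  qed
  have "real (card ?T) * exp (s * t) = (\<Sum>A\<in>?T. exp (s * t))"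
    by simp
  also have "\<dots> \<le> (\<Sum>A\<in>?T. exp (s * ?c A) + exp (- s * ?c A))"
    by (rule sum_mono) (rule markov)
  also have "\<dots> \<le> (\<Sum>A\<in>binary_sequences n. exp (s * ?c A) + exp (- s * ?c A))"
    by (rule sum_mono2) (auto simp: finite_binary_sequences add_nonneg_nonneg)
  also have "\<dots> = 2 ^ n * (2 * cosh s ^ (n - k))"
    using autocorrelation_mgf[OF k(1), where n = n and s = s]
      autocorrelation_mgf[OF k(1), where n = n and s = "- s"]
    by (simp add: sum.distrib)
  also have "\<dots> \<le> 2 ^ n * (2 * exp (s\<^sup>2 / 2) ^ (n - k))"
    by (intro mult_left_mono power_mono cosh_le_exp_half_square) auto
  also have "exp (s\<^sup>2 / 2) ^ (n - k) = exp (m * (s\<^sup>2 / 2))"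
    by (simp only: m_def exp_of_nat_mult)
  also have "m * (s\<^sup>2 / 2) = s * t - t\<^sup>2 / (2 * m)"
    using m by (simp add: s_def power2_eq_square field_simps)
  also have "exp (s * t - t\<^sup>2 / (2 * m)) = exp (s * t) * exp (- (t\<^sup>2 / (2 * m)))"
    by (simp flip: exp_add)
  finally have "real (card ?T) * exp (s * t)
      \<le> (2 ^ n * (2 * exp (- (t\<^sup>2 / (2 * m))))) * exp (s * t)"
    by (simp only: mult_ac)
  then have "real (card ?T) \<le> 2 ^ n * (2 * exp (- (t\<^sup>2 / (2 * m))))"
    by (rule mult_right_le_imp_le) simp
  then show ?thesis
    unfolding proportion_def m_def[symmetric] by (simp only: pos_divide_le_eq zero_less_power
      zero_less_numeral mult.commute)
qed

section \<open>Combining the shifts\<close>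

lemma proportion_peak_sidelobe_level_le:
  assumes "n \<ge> 2"
  shows "proportion n (\<lambda>A. real_of_int (peak_sidelobe_level A) > t)
    \<le> (\<Sum>k=1..<n. proportion n (\<lambda>A. real_of_int \<bar>autocorrelation A k\<bar> > t))"
proof -
  let ?T = "\<lambda>k. {A \<in> binary_sequences n. real_of_int \<bar>autocorrelation A k\<bar> > t}"
  have "{A \<in> binary_sequences n. real_of_int (peak_sidelobe_level A) > t} \<subseteq> (\<Union>k\<in>{1..<n}. ?T k)"
  proof
    fix A
    assume A: "A \<in> {A \<in> binary_sequences n. real_of_int (peak_sidelobe_level A) > t}"
    then have len: "length A = n"
      by (simp add: binary_sequences_def)
    have "peak_sidelobe_level A \<in> (\<lambda>k. \<bar>autocorrelation A k\<bar>) ` {1..length A - 1}"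
      unfolding peak_sidelobe_level_def using assms len by (intro Max_in) auto
    then obtain k where "k \<in> {1..n - 1}" "peak_sidelobe_level A = \<bar>autocorrelation A k\<bar>"
      using len by auto
    then show "A \<in> (\<Union>k\<in>{1..<n}. ?T k)"
      using A by (intro UN_I[of k]) auto
  qed
  then have "card {A \<in> binary_sequences n. real_of_int (peak_sidelobe_level A) > t}
      \<le> card (\<Union>k\<in>{1..<n}. ?T k)"
    by (intro card_mono) (auto simp: finite_binary_sequences)
  also have "\<dots> \<le> (\<Sum>k=1..<n. card (?T k))"
    by (rule card_UN_le) simp
  finally have "real (card {A \<in> binary_sequences n. real_of_int (peak_sidelobe_level A) > t})
      \<le> (\<Sum>k=1..<n. real (card (?T k)))"
    by (simp only: of_nat_le_iff flip: of_nat_sum)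
  then show ?thesis
    unfolding proportion_def sum_divide_distrib[symmetric] by (rule divide_right_mono) simp
qed

text \<open>
  The inequality $n/(n-k) \ge 1 + k/n$ replaces the summands by $e^{-p} q^k$ with $q = e^{-p/n}$,
  and $q/(1-q) = 1/(e^{p/n} - 1) \le n/p$ because $e^x \ge 1 + x$.
\<close>

lemma sum_tail_bounds_le:
  fixes p :: real
  assumes p: "p > 0"
  shows "(\<Sum>k=1..<n. exp (- (real n * p / real (n - k)))) \<le> exp (- p) * (real n / p)"
proof (cases "n = 0")
  case False
  then have n: "real n > 0"
    by simp
  define q where "q = exp (- (p / real n))"
  have q: "0 < q" "q < 1"
    using p n by (simp_all add: q_def)
  have term_le: "exp (- (real n * p / real (n - k))) \<le> exp (- p) * q ^ k"
    if "k \<in> {1..<n}" for k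
  proof -
    have pos: "real n - real k > 0"
      using that by simp
    have "(real n + real k) * (real n - real k) \<le> real n * real n"
      by (simp add: algebra_simps)
    then have "(real n + real k) / real n \<le> real n / (real n - real k)"
      using n pos by (simp add: field_simps)
    then have "p * ((real n + real k) / real n) \<le> p * (real n / (real n - real k))"
      using p by (intro mult_left_mono) auto
    then have "p + real k * (p / real n) \<le> real n * p / real (n - k)"
      using n that by (simp add: field_simps of_nat_diff)
    moreover have "exp (- p) * q ^ k = exp (- (p + real k * (p / real n)))"
      by (simp add: q_def flip: exp_of_nat_mult exp_add)
    ultimately show ?thesis
      by simp
  qed
  have "1 + p / real n \<le> exp (p / real n)"
    by (rule exp_ge_add_one_self)
  then have "(1 + p / real n) * q \<le> exp (p / real n) * q"
    using q by (intro mult_right_mono) auto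
  also have "\<dots> = 1"
    by (simp add: q_def flip: exp_add)
  finally have ratio: "q / (1 - q) \<le> real n / p"
    using p n q by (simp add: field_simps)
  have "(\<Sum>k=1..<n. q ^ k) \<le> (\<Sum>k=1..n. q ^ k)"
    using q by (intro sum_mono2) auto
  also have "\<dots> = q * (1 - q ^ n) / (1 - q)"
    using q n by (simp add: sum_gp algebra_simps)
  also have "\<dots> \<le> q / (1 - q)"
    using q by (intro divide_right_mono) (auto simp: mult_le_cancel_left1)
  also note ratio
  finally have geometric: "(\<Sum>k=1..<n. q ^ k) \<le> real n / p" .
  have "(\<Sum>k=1..<n. exp (- (real n * p / real (n - k)))) \<le> exp (- p) * (\<Sum>k=1..<n. q ^ k)"
    unfolding sum_distrib_left by (rule sum_mono) (rule term_le)
  also have "\<dots> \<le> exp (- p) * (real n / p)"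
    by (intro mult_left_mono geometric) simp
  finally show ?thesis .
qed simp

theorem proposition1:
  fixes \<psi> :: "nat \<Rightarrow> real" and n :: nat
  assumes "\<And>m. m \<ge> 2 \<Longrightarrow> \<psi> m > 0"
    and "n \<ge> 2"
  shows "proportion n (\<lambda>A. real_of_int (peak_sidelobe_level A) > sqrt (2 * real n * \<psi> n))
           \<le> 2 * real n / (\<psi> n * exp (\<psi> n))"
proof -
  let ?t = "sqrt (2 * real n * \<psi> n)"
  have pos: "\<psi> n > 0"
    using assms by blast
  have exponent: "?t\<^sup>2 / (2 * x) = real n * \<psi> n / x" for x
    using pos by (simp add: mult.assoc)
  have "proportion n (\<lambda>A. real_of_int (peak_sidelobe_level A) > ?t)
      \<le> (\<Sum>k=1..<n. proportion n (\<lambda>A. real_of_int \<bar>autocorrelation A k\<bar> > ?t))"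
    by (rule proportion_peak_sidelobe_level_le) fact
  also have "\<dots> \<le> (\<Sum>k=1..<n. 2 * exp (- (?t\<^sup>2 / (2 * real (n - k)))))"
    using pos by (intro sum_mono autocorrelation_tail) auto
  also have "\<dots> = 2 * (\<Sum>k=1..<n. exp (- (real n * \<psi> n / real (n - k))))"
    by (simp only: exponent sum_distrib_left)
  also have "\<dots> \<le> 2 * (exp (- \<psi> n) * (real n / \<psi> n))"
    using pos by (intro mult_left_mono sum_tail_bounds_le) auto
  also have "\<dots> = 2 * real n / (\<psi> n * exp (\<psi> n))"
    by (simp add: exp_minus field_simps)
  finally show ?thesis .
qed

end
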